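(* Let $a\in\mathbb{R}$ and let $s\in\mathbb{C}$ with $\operatorname{Re}(s)>0$. Then $J^s$ is a linear operator over $E$: for all $f,g\in E$, all $\lambda,\mu\in\mathbb{C}$ and all $x>a$, $$J^s(\lambda f+\mu g)(x)=\lambda J^s(f)(x)+\mu J^s(g)(x).$$
   Context: $E$ denotes the set of integrable and derivable causal functions $f$ on $I=\,]a,+\infty[$: complex-valued functions, differentiable on $]a,+\infty[$, integrable on $]a,x[$ for every $x>a$, and extended by $f(x)=0$ for $x\le a$. For $s\in\mathbb{C}$ with $\operatorname{Re}(s)>0$, the $s$-order integral operator is $$J^s(f)(x)=\frac{1}{\Gamma(s)}\int_a^x (x-y)^{s-1}f(y)\,dy,\qquad x>a,$$ where $\Gamma$ is Euler's gamma function. *)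

theory Defs
  imports "HOL-Analysis.Analysis"
begin

text \<open>Differentiability is that of a complex-valued function of a real variable;
  integrability is Lebesgue (absolute) integrability.\<close>

definition causal_space :: "real \<Rightarrow> (real \<Rightarrow> complex) set" where
  "causal_space a =
     {f. (\<forall>x>a. f differentiable (at x)) \<and>
         (\<forall>x>a. set_integrable lborel {a<..<x} f) \<and>
         (\<forall>x\<le>a. f x = 0)}"

text \<open>The base of the power is a positive real for \<open>y < x\<close>, so the principal branch
  gives \<open>exp ((s - 1) * ln (x - y))\<close>.\<close>

definition J_integrand :: "complex \<Rightarrow> (real \<Rightarrow> complex) \<Rightarrow> real \<Rightarrow> real \<Rightarrow> complex" where
  "J_integrand s f x y = complex_of_real (x - y) powr (s - 1) * f y"

text \<open>For \<open>x \<le> a\<close> the domain of integration is empty and the value is \<open>0\<close>, so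
  \<open>J_op a s f\<close> is already the extension by zero of the function on \<open>x > a\<close>.\<close>

definition J_op :: "real \<Rightarrow> complex \<Rightarrow> (real \<Rightarrow> complex) \<Rightarrow> real \<Rightarrow> complex" where
  "J_op a s f x =
     1 / Gamma s * (LINT y:{a<..<x}|lborel. J_integrand s f x y)"

end

(* With V continuous on (a,oo) and locally integrable near a, the convolution of V with
   t_+^(s-1) is continuous on (a,oo), and by Fubini its primitive is 1/s times the convolution
   of V with t_+^s.  Since f' need be neither continuous nor locally integrable, differentiability
   of J^s f at a point x is not obtained by moving the derivative onto f.  Instead write
   f(y) = f(x) + (y - x) v(y) with v the difference quotient at x, which is continuous, and
   y - x = (z - x) - (z - y).  This gives
     int_a^z (z-y)^(s-1) f(y) dy
       = f(x) (z-a)^s / s + (z - x) H(z) - s int_a^z H(w) dw,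
   where H(z) = int_a^z (z-y)^(s-1) v(y) dy is continuous; each summand is differentiable
   at z = x. *)

theory Submission
  imports Defs
begin

section \<open>The truncated power kernel and its integrals\<close>

text \<open>The truncated power t_+^(s-1). Cutting it off inside the kernel puts the upper limit y <
  x into \<open>rl_kernel s (x - y)\<close>, so the integrals can run over the whole line.\<close>

definition rl_kernel :: "complex \<Rightarrow> real \<Rightarrow> complex" where
  "rl_kernel s t = (if t > 0 then of_real t powr (s - 1) else 0)"

lemma rl_kernel_0: "rl_kernel s 0 = 0"
  by (simp add: rl_kernel_def)

lemma rl_kernel_exp: "rl_kernel s t = (if t > 0 then exp ((s - 1) * of_real (ln t)) else 0)"
  by (simp add: rl_kernel_def powr_def Ln_of_real)

lemma rl_kernel_measurable [measurable]: "rl_kernel s \<in> borel_measurable borel"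
  unfolding rl_kernel_exp[abs_def] by measurable

lemma norm_rl_kernel: "norm (rl_kernel s t) = (if t > 0 then t powr (Re s - 1) else 0)"
  by (simp add: rl_kernel_def norm_powr_real_powr)

text \<open>Absorbs the factor z - y that arises when f is expanded around x, at the price of
  raising the order by one.\<close>

lemma mult_rl_kernel: "of_real t * rl_kernel s t = rl_kernel (s + 1) t"
  by (cases "t > 0") (simp_all add: rl_kernel_def powr_diff)

lemma rl_kernel_has_vector_derivative:
  assumes "t > 0"
  shows "(rl_kernel (s + 1) has_vector_derivative s * rl_kernel s t) (at t)"
proof -
  have "((\<lambda>z. z powr s) has_field_derivative s * of_real t powr (s - 1)) (at (complex_of_real t))"
    using assms by (intro has_field_derivative_powr) auto
  then have "((\<lambda>x. complex_of_real x powr s) has_vector_derivative s * of_real t powr (s - 1)) (at t)"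
    by (rule has_vector_derivative_real_field)
  then have "((\<lambda>x. complex_of_real x powr s) has_vector_derivative s * rl_kernel s t) (at t)"
    using assms by (simp add: rl_kernel_def)
  then show ?thesis
    by (rule has_vector_derivative_transform_within_open[where S="{0<..}"])
       (use assms in \<open>auto simp: rl_kernel_def\<close>)
qed

lemma isCont_rl_kernel: "t > 0 \<Longrightarrow> isCont (rl_kernel s) t"
  \<comment> \<open>The kernel of order s is the kernel of order (s - 1) + 1, hence differentiable
    at t.\<close>
  using has_vector_derivative_continuous[OF rl_kernel_has_vector_derivative[of t "s - 1"]] by simp

text \<open>Only the point 0 requires Re s > 0: there the norm is t_+^(Re s), which tends to
  0.\<close>

lemma continuous_on_rl_kernel_Suc:
  assumes "Re s > 0"
  shows "continuous_on {0..T} (rl_kernel (s + 1))"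
proof (rule continuous_at_imp_continuous_on, safe)
  fix t :: real assume t: "t \<in> {0..T}"
  show "isCont (rl_kernel (s + 1)) t"
  proof (cases "t > 0")
    case True then show ?thesis by (rule isCont_rl_kernel)
  next
    case False
    with t have "t = 0" by simp
    have "((\<lambda>u::real. max 0 u powr Re s) \<longlongrightarrow> 0) (at 0)"
      by (rule tendsto_zero_powrI[where b="Re s"])
         (use assms in \<open>auto intro!: tendsto_eq_intros\<close>)
    moreover have "max 0 u powr Re s = norm (rl_kernel (s + 1) u)" for u
      by (simp add: norm_rl_kernel max_def)
    ultimately have "(rl_kernel (s + 1) \<longlongrightarrow> 0) (at 0)"
      by (simp add: tendsto_norm_zero_iff)
    then show ?thesis
      using \<open>t = 0\<close> by (simp add: isCont_def rl_kernel_def)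
  qed
qed

text \<open>The norm of t^(s-1) is t^(Re s - 1), integrable at 0 because the exponent exceeds -1.
  The domain \<open>{..T}\<close> instead of \<open>{0..T}\<close> covers T \<le> 0 as well, where
  everything vanishes.\<close>

lemma norm_rl_kernel_integral:
  assumes "Re s > 0"
  shows "integrable lborel (\<lambda>t. indicator {..T} t *\<^sub>R norm (rl_kernel s t))" (is ?A)
    and "(\<integral>t. indicator {..T} t *\<^sub>R norm (rl_kernel s t) \<partial>lborel) = norm (rl_kernel (s + 1) T) / Re s" (is ?B)
proof -
  have "?A \<and> ?B"
  proof (cases "T > 0")
    case False
    then have "(\<lambda>t. indicator {..T} t *\<^sub>R norm (rl_kernel s t)) = (\<lambda>_. 0)"
      by (auto simp: fun_eq_iff norm_rl_kernel)
    then show ?thesis using False by (simp add: norm_rl_kernel)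
  next
    case True
    have eq: "(\<lambda>t. indicator {..T} t *\<^sub>R norm (rl_kernel s t)) = (\<lambda>t. indicator {0..T} t *\<^sub>R t powr (Re s - 1))"
      by (auto simp: fun_eq_iff norm_rl_kernel indicator_def)
    have hi: "((\<lambda>x. x powr (Re s - 1)) has_integral T powr Re s / Re s) {0..T}"
      using has_integral_powr_from_0[of "Re s - 1" T] assms True by simp
    \<comment> \<open>Nonnegativity upgrades the gauge integral to absolute integrability;
      \<open>integrable_completion\<close> then passes from the completed measure to
      \<open>lborel\<close>.\<close>
    have "(\<lambda>x. x powr (Re s - 1)) absolutely_integrable_on {0..T}"
      using hi by (intro nonnegative_absolutely_integrable_1) auto
    then have int: "set_integrable lborel {0..T} (\<lambda>x. x powr (Re s - 1))"
      unfolding set_integrable_def by (subst (asm) integrable_completion) auto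
    have "(LINT x:{0..T}|lborel. x powr (Re s - 1)) = T powr Re s / Re s"
      using set_borel_integral_eq_integral(2)[OF int] hi by (simp add: integral_unique)
    then show ?thesis
      using int True unfolding eq set_integrable_def set_lebesgue_integral_def
      by (simp add: norm_rl_kernel)
  qed
  then show ?A ?B by auto
qed

text \<open>The primitive is \<open>rl_kernel (s + 1)\<close> divided by s. The kernel may be
  unbounded at 0, so the interior form of the fundamental theorem is applied: a derivative on the
  open interval and a continuous primitive on the closed one.\<close>

lemma rl_kernel_integral:
  assumes "Re s > 0"
  shows "integrable lborel (\<lambda>t. indicator {..T} t *\<^sub>R rl_kernel s t)" (is ?A)
    and "(\<integral>t. indicator {..T} t *\<^sub>R rl_kernel s t \<partial>lborel) = rl_kernel (s + 1) T / s" (is ?B)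
proof -
  show A: ?A
    by (rule Bochner_Integration.integrable_bound[OF norm_rl_kernel_integral(1)[OF assms, of T]]) auto
  have s: "s \<noteq> 0" using assms by auto
  show ?B
  proof (cases "T > 0")
    case False
    then have "(\<lambda>t. indicator {..T} t *\<^sub>R rl_kernel s t) = (\<lambda>_. 0)"
      by (auto simp: fun_eq_iff rl_kernel_def)
    then show ?thesis using False by (simp add: rl_kernel_def)
  next
    case True
    have eq: "(\<lambda>t. indicator {..T} t *\<^sub>R rl_kernel s t) = (\<lambda>t. indicator {0..T} t *\<^sub>R rl_kernel s t)"
      by (auto simp: fun_eq_iff rl_kernel_def indicator_def)
    have "((\<lambda>t. s * rl_kernel s t) has_integral rl_kernel (s + 1) T - rl_kernel (s + 1) 0) {0..T}"
      using True assms
      by (intro fundamental_theorem_of_calculus_interior rl_kernel_has_vector_derivative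
           continuous_on_rl_kernel_Suc) auto
    from has_integral_mult_right[OF this, of "1 / s"]
    have hi: "(rl_kernel s has_integral rl_kernel (s + 1) T / s) {0..T}"
      using s by (simp add: rl_kernel_0)
    have int: "set_integrable lborel {0..T} (rl_kernel s)"
      using A unfolding eq set_integrable_def .
    show ?thesis
      using set_borel_integral_eq_integral(2)[OF int] hi
      unfolding eq set_lebesgue_integral_def by (simp add: integral_unique)
  qed
qed

text \<open>Substituting t = x - y turns y \<ge> a into t \<le> x - a. This evaluates the
  convolution of the kernel with a constant on [a,oo), the contribution of f(x) in the later
  decomposition.\<close>

lemma rl_kernel_reflect_integral:
  assumes "Re s > 0"
  shows "integrable lborel (\<lambda>y. indicator {a..} y *\<^sub>R rl_kernel s (x - y))"
    and "(\<integral>y. indicator {a..} y *\<^sub>R rl_kernel s (x - y) \<partial>lborel) = rl_kernel (s + 1) (x - a) / s"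
proof -
  have eq: "(\<lambda>y. indicator {a..} y *\<^sub>R rl_kernel s (x - y)) =
      (\<lambda>y. indicator {..x - a} (x + (-1) * y) *\<^sub>R rl_kernel s (x + (-1) * y))"
    by (auto simp: fun_eq_iff indicator_def)
  show "integrable lborel (\<lambda>y. indicator {a..} y *\<^sub>R rl_kernel s (x - y))"
    unfolding eq by (rule lborel_integrable_real_affine[OF rl_kernel_integral(1)[OF assms, of "x - a"]]) simp
  show "(\<integral>y. indicator {a..} y *\<^sub>R rl_kernel s (x - y) \<partial>lborel) = rl_kernel (s + 1) (x - a) / s"
    unfolding eq rl_kernel_integral(2)[OF assms, symmetric]
    by (subst lborel_integral_real_affine[where c="-1" and t=x]) auto
qed

section \<open>Continuous causal functions and their convolution with the kernel\<close>

text \<open>Larger than \<open>causal_space\<close>: a difference quotient at x need not be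
  differentiable at x, but it does belong to this class.\<close>

definition cont_causal :: "real \<Rightarrow> (real \<Rightarrow> complex) set" where
  "cont_causal a = {V. (\<forall>y\<le>a. V y = 0) \<and> continuous_on {a<..} V \<and>
     (\<forall>x>a. set_integrable lborel {a<..<x} V)}"

text \<open>For causal V this is Gamma(s) J^s(V), without the normalising factor.\<close>

definition rl_conv :: "complex \<Rightarrow> (real \<Rightarrow> complex) \<Rightarrow> real \<Rightarrow> complex" where
  "rl_conv s V x = (\<integral>y. rl_kernel s (x - y) * V y \<partial>lborel)"

lemma cont_causal_measurable:
  assumes "V \<in> cont_causal a"
  shows "V \<in> borel_measurable borel"
proof -
  have "V = (\<lambda>y. indicator {a<..} y *\<^sub>R V y)"
    using assms by (auto simp: fun_eq_iff cont_causal_def indicator_def)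
  also have "\<dots> \<in> borel_measurable borel"
    using assms by (intro borel_measurable_continuous_on_indicator) (auto simp: cont_causal_def)
  finally show ?thesis .
qed

lemma cont_causal_isCont:
  assumes "V \<in> cont_causal a" "a < y"
  shows "isCont V y"
  using assms by (auto simp: cont_causal_def continuous_on_eq_continuous_at)

lemma cont_causal_integrable:
  assumes "V \<in> cont_causal a"
  shows "integrable lborel (\<lambda>y. indicator {..x} y *\<^sub>R V y)"
proof -
  have pos: "a < y" if "V y \<noteq> 0" for y
    using that assms unfolding cont_causal_def by (metis (mono_tags, lifting) mem_Collect_eq not_less)
  \<comment> \<open>The endpoint lies strictly above both a and x, so the open interval contains
    every point of \<open>{..x}\<close> where V is nonzero, x included, and is a legitimate choice
    even when x \<le> a.\<close>
  have "set_integrable lborel {a<..<max a x + 1} V"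
    using assms by (simp add: cont_causal_def)
  then have "set_integrable lborel ({a<..<max a x + 1} \<inter> {..x}) V"
    by (rule set_integrable_subset) auto
  also have "set_integrable lborel ({a<..<max a x + 1} \<inter> {..x}) V \<longleftrightarrow> set_integrable lborel {..x} V"
    unfolding set_integrable_def
    by (intro Bochner_Integration.integrable_cong) (auto simp: indicator_def pos)
  finally show ?thesis unfolding set_integrable_def .
qed

text \<open>Integrability has to be checked only near a: on a compact interval to the right of a it
  follows from continuity.\<close>

lemma cont_causalI:
  assumes "\<And>y. y \<le> a \<Longrightarrow> V y = 0" "continuous_on {a<..} V" "a < b" "set_integrable lborel {a<..<b} V"
  shows "V \<in> cont_causal a"
proof -
  have "set_integrable lborel {a<..<x} V" if "a < x" for x
  proof -
    define c where "c = (a + b) / 2"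
    have c: "a < c" "c < b" using assms(3) by (auto simp: c_def)
    have "set_integrable lborel {c..x} V"
      by (rule borel_integrable_atLeastAtMost') (use assms(2) c in \<open>auto intro: continuous_on_subset\<close>)
    then have "set_integrable lborel ({a<..<b} \<union> {c..x}) V"
      by (intro set_integrable_Un assms) auto
    then show ?thesis
      by (rule set_integrable_subset) (use c in auto)
  qed
  then show ?thesis using assms by (auto simp: cont_causal_def)
qed

lemma cont_causal_bounded:
  assumes "V \<in> cont_causal a" "a < b"
  obtains M where "M \<ge> 0" "\<And>y. b \<le> y \<Longrightarrow> y \<le> c \<Longrightarrow> norm (V y) \<le> M"
proof -
  have "compact (V ` {b..c})"
    by (rule compact_continuous_image)
      (use assms in \<open>auto simp: cont_causal_def intro: continuous_on_subset\<close>)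
  then obtain M where "M > 0" "\<forall>z\<in>V ` {b..c}. norm z \<le> M"
    using compact_imp_bounded bounded_pos by blast
  then show ?thesis by (intro that[of M]) auto
qed

section \<open>Separating the singularity of the kernel from that of the function\<close>

text \<open>A real power is monotone in one direction or the other, so one endpoint always
  dominates; the sum spares a case distinction on the sign of Re s - 1.\<close>

lemma powr_le_sum_endpoints:
  fixes p :: real
  assumes "0 < l" "l \<le> t" "t \<le> u"
  shows "t powr p \<le> l powr p + u powr p"
proof (cases "p \<ge> 0")
  case True
  then have "t powr p \<le> u powr p" using assms by (intro powr_mono2) auto
  then show ?thesis by (smt (verit) powr_ge_zero)
next
  case False
  then have "t powr p \<le> l powr p" using assms by (intro powr_mono2') auto
  then show ?thesis by (smt (verit) powr_ge_zero)
qed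

text \<open>Where a < y \<le> b, the argument x - y stays in [c - b, d - a], away from 0, so the
  kernel is bounded. The constant is uniform in x, as dominated convergence demands.\<close>

lemma rl_far_bound:
  assumes "V \<in> cont_causal a" "b < c"
  obtains C where "\<And>x y. c \<le> x \<Longrightarrow> x \<le> d \<Longrightarrow>
    norm (rl_kernel s (x - y) * (indicator {..b} y *\<^sub>R V y)) \<le> C * norm (indicator {..b} y *\<^sub>R V y)"
proof (rule that)
  fix x y assume x: "c \<le> x" "x \<le> d"
  let ?C = "(c - b) powr (Re s - 1) + (d - a) powr (Re s - 1)"
  show "norm (rl_kernel s (x - y) * (indicator {..b} y *\<^sub>R V y)) \<le> ?C * norm (indicator {..b} y *\<^sub>R V y)"
  proof (cases "a < y \<and> y \<le> b")
    case True
    have "norm (rl_kernel s (x - y)) \<le> ?C"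
      using True x assms(2) powr_le_sum_endpoints[of "c - b" "x - y" "d - a"]
      by (auto simp: norm_rl_kernel)
    then show ?thesis
      unfolding norm_mult by (intro mult_right_mono) auto
  next
    case False
    then have "indicator {..b} y *\<^sub>R V y = 0"
      using assms(1) by (auto simp: indicator_def cont_causal_def)
    then show ?thesis by (simp del: norm_scaleR scaleR_eq_0_iff)
  qed
qed

text \<open>In the variable t = x - y the singular kernel does not move with x, and for t > 0 the
  function is evaluated only inside [b, d], where compactness bounds it.\<close>

lemma rl_near_bound:
  assumes "V \<in> cont_causal a" "a < b"
  obtains M where "\<And>x t. x \<le> d \<Longrightarrow>
    norm (rl_kernel s t * (indicator {b<..} (x - t) *\<^sub>R V (x - t))) \<le>
      M * (indicator {..d - b} t *\<^sub>R norm (rl_kernel s t))"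
proof -
  obtain M where M: "M \<ge> 0" "\<And>y. b \<le> y \<Longrightarrow> y \<le> d \<Longrightarrow> norm (V y) \<le> M"
    using cont_causal_bounded[OF assms, of d] by blast
  show ?thesis
  proof (rule that)
    fix x t assume x: "x \<le> d"
    show "norm (rl_kernel s t * (indicator {b<..} (x - t) *\<^sub>R V (x - t))) \<le>
      M * (indicator {..d - b} t *\<^sub>R norm (rl_kernel s t))"
    proof (cases "0 < t \<and> t < x - b")
      case True
      then have "norm (V (x - t)) \<le> M" using x by (intro M) auto
      then have "norm (rl_kernel s t) * norm (V (x - t)) \<le> norm (rl_kernel s t) * M"
        by (rule mult_left_mono) auto
      then show ?thesis using True x by (simp add: norm_mult mult.commute)
    next
      case False
      then have "rl_kernel s t * (indicator {b<..} (x - t) *\<^sub>R V (x - t)) = 0"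
        by (auto simp: rl_kernel_def indicator_def)
      then show ?thesis
        using M(1) by (simp only: norm_zero) simp
    qed
  qed
qed

lemma rl_far_integrable:
  assumes "V \<in> cont_causal a" "b < x"
  shows "integrable lborel (\<lambda>y. rl_kernel s (x - y) * (indicator {..b} y *\<^sub>R V y))"
proof -
  note [measurable] = cont_causal_measurable[OF assms(1)]
  \<comment> \<open>The far bound on the degenerate range c = d = x.\<close>
  obtain C where C: "\<And>z y. x \<le> z \<Longrightarrow> z \<le> x \<Longrightarrow>
    norm (rl_kernel s (z - y) * (indicator {..b} y *\<^sub>R V y)) \<le> C * norm (indicator {..b} y *\<^sub>R V y)"
    using rl_far_bound[OF assms, where d=x and s=s] by blast
  show ?thesis
    by (rule Bochner_Integration.integrable_bound[where f="\<lambda>y. C * norm (indicator {..b} y *\<^sub>R V y)"])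
      (use C[of x] in \<open>auto intro!: cont_causal_integrable[OF assms(1)] order_trans[OF _ abs_ge_self]
        simp del: norm_scaleR\<close>)
qed

lemma rl_near_integrable:
  assumes "V \<in> cont_causal a" "a < b" "Re s > 0"
  shows "integrable lborel (\<lambda>t. rl_kernel s t * (indicator {b<..} (x - t) *\<^sub>R V (x - t)))"
proof -
  note [measurable] = cont_causal_measurable[OF assms(1)]
  obtain M where M: "\<And>z t. z \<le> x \<Longrightarrow>
    norm (rl_kernel s t * (indicator {b<..} (z - t) *\<^sub>R V (z - t))) \<le>
      M * (indicator {..x - b} t *\<^sub>R norm (rl_kernel s t))"
    using rl_near_bound[OF assms(1,2), where d=x and s=s] by blast
  show ?thesis
  proof (rule Bochner_Integration.integrable_bound)
    show "integrable lborel (\<lambda>t. M * (indicator {..x - b} t *\<^sub>R norm (rl_kernel s t)))"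
      using norm_rl_kernel_integral(1)[OF assms(3)] by (rule integrable_mult_right)
  qed (use M[of x] in \<open>auto intro!: order_trans[OF _ abs_ge_self] simp del: real_scaleR_def\<close>)
qed

text \<open>V may be singular at a and the kernel at y = x. The cut at b separates the two: the far
  part stays in y, the near part is rewritten in t = x - y, so in each part the singular factor is
  independent of x.\<close>

lemma
  assumes "V \<in> cont_causal a" "a < b" "b < x" "Re s > 0"
  shows rl_integrable_aux: "integrable lborel (\<lambda>y. rl_kernel s (x - y) * V y)"
    and rl_conv_split: "rl_conv s V x = (\<integral>y. rl_kernel s (x - y) * (indicator {..b} y *\<^sub>R V y) \<partial>lborel) +
      (\<integral>t. rl_kernel s t * (indicator {b<..} (x - t) *\<^sub>R V (x - t)) \<partial>lborel)"
proof -
  let ?n = "\<lambda>t. rl_kernel s t * (indicator {b<..} (x - t) *\<^sub>R V (x - t))"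
  let ?f = "\<lambda>y. rl_kernel s (x - y) * (indicator {..b} y *\<^sub>R V y)"
  let ?g = "\<lambda>y. rl_kernel s (x - y) * (indicator {b<..} y *\<^sub>R V y)"
  have n: "integrable lborel ?n" by (rule rl_near_integrable[OF assms(1,2,4)])
  have f: "integrable lborel ?f" by (rule rl_far_integrable[OF assms(1,3)])
  have g: "integrable lborel ?g"
    using lborel_integrable_real_affine[OF n, of "-1" x] by simp
  have gn: "integral\<^sup>L lborel ?n = integral\<^sup>L lborel ?g"
    by (subst lborel_integral_real_affine[where c="-1" and t=x]) auto
  have eq: "(\<lambda>y. rl_kernel s (x - y) * V y) = (\<lambda>y. ?f y + ?g y)"
    by (auto simp: fun_eq_iff indicator_def)
  show "integrable lborel (\<lambda>y. rl_kernel s (x - y) * V y)"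
    unfolding eq by (rule Bochner_Integration.integrable_add[OF f g])
  show "rl_conv s V x = integral\<^sup>L lborel ?f + integral\<^sup>L lborel ?n"
    unfolding rl_conv_def eq gn by (rule Bochner_Integration.integral_add[OF f g])
qed

lemma rl_conv_eq_0:
  assumes "V \<in> cont_causal a" "x \<le> a"
  shows "rl_kernel s (x - y) * V y = 0" "rl_conv s V x = 0"
proof -
  show *: "rl_kernel s (x - y) * V y = 0" for y
    using assms by (cases "y \<le> a") (auto simp: cont_causal_def rl_kernel_def)
  show "rl_conv s V x = 0"
    unfolding rl_conv_def * by simp
qed

lemma rl_integrable:
  assumes "V \<in> cont_causal a" "Re s > 0"
  shows "integrable lborel (\<lambda>y. rl_kernel s (x - y) * V y)"
proof (cases "a < x")
  case True
  then show ?thesis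
    using rl_integrable_aux[OF assms(1) _ _ assms(2), of "(a + x) / 2" x] by simp
next
  case False
  then show ?thesis by (subst rl_conv_eq_0(1)[OF assms(1)]) auto
qed

section \<open>Continuity and primitive of the convolution\<close>

text \<open>Dominated convergence on the two parts separately: in the far part the kernel is the
  moving continuous factor, in the near part V is.\<close>

lemma rl_conv_continuous:
  assumes V: "V \<in> cont_causal a" and "Re s > 0"
  shows "continuous_on {a<..} (rl_conv s V)"
proof (rule continuous_at_imp_continuous_on, safe)
  note [measurable] = cont_causal_measurable[OF V]
  fix x :: real assume "a < x"
  \<comment> \<open>Thirds of [a, x]: points near x stay above c, hence at a fixed positive distance
    from the cut b.\<close>
  define b where "b = (2 * a + x) / 3"
  define c where "c = (a + 2 * x) / 3"
  have b: "a < b" "b < c" "c < x" using \<open>a < x\<close> by (auto simp: b_def c_def)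
  let ?S = "{c<..<x + 1}"
  obtain C where C: "\<And>z y. c \<le> z \<Longrightarrow> z \<le> x + 1 \<Longrightarrow>
    norm (rl_kernel s (z - y) * (indicator {..b} y *\<^sub>R V y)) \<le> C * norm (indicator {..b} y *\<^sub>R V y)"
    using rl_far_bound[OF V b(2), where d="x + 1" and s=s] by blast
  obtain M where M: "\<And>z t. z \<le> x + 1 \<Longrightarrow>
    norm (rl_kernel s t * (indicator {b<..} (z - t) *\<^sub>R V (z - t))) \<le>
      M * (indicator {..x + 1 - b} t *\<^sub>R norm (rl_kernel s t))"
    using rl_near_bound[OF V b(1), where d="x + 1" and s=s] by blast
  have "continuous (at x within ?S) (rl_conv s V)"
  proof (rule continuous_within_sequentiallyI)
    fix u :: "nat \<Rightarrow> real" assume u: "u \<longlonglongrightarrow> x" "\<forall>n. u n \<in> ?S"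
    have "(\<lambda>n. \<integral>y. rl_kernel s (u n - y) * (indicator {..b} y *\<^sub>R V y) \<partial>lborel)
        \<longlonglongrightarrow> (\<integral>y. rl_kernel s (x - y) * (indicator {..b} y *\<^sub>R V y) \<partial>lborel)"
    proof (rule integral_dominated_convergence)
      show "integrable lborel (\<lambda>y. C * norm (indicator {..b} y *\<^sub>R V y))"
        by (intro integrable_mult_right integrable_norm cont_causal_integrable[OF V])
      show "AE y in lborel. norm (rl_kernel s (u n - y) * (indicator {..b} y *\<^sub>R V y))
          \<le> C * norm (indicator {..b} y *\<^sub>R V y)" for n
        using C[of "u n"] u(2) by (auto simp: less_imp_le simp del: norm_scaleR)
      show "AE y in lborel. (\<lambda>n. rl_kernel s (u n - y) * (indicator {..b} y *\<^sub>R V y))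
          \<longlonglongrightarrow> rl_kernel s (x - y) * (indicator {..b} y *\<^sub>R V y)"
      proof (rule AE_I2)
        fix y
        show "(\<lambda>n. rl_kernel s (u n - y) * (indicator {..b} y *\<^sub>R V y))
          \<longlonglongrightarrow> rl_kernel s (x - y) * (indicator {..b} y *\<^sub>R V y)"
        proof (cases "y \<le> b")
          case True
          then have "(\<lambda>n. rl_kernel s (u n - y)) \<longlonglongrightarrow> rl_kernel s (x - y)"
            using b by (intro isCont_tendsto_compose[OF isCont_rl_kernel] tendsto_intros u) auto
          then show ?thesis by (intro tendsto_intros)
        qed simp
      qed
    qed measurable
    moreover have "(\<lambda>n. \<integral>t. rl_kernel s t * (indicator {b<..} (u n - t) *\<^sub>R V (u n - t)) \<partial>lborel)
        \<longlonglongrightarrow> (\<integral>t. rl_kernel s t * (indicator {b<..} (x - t) *\<^sub>R V (x - t)) \<partial>lborel)"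
    proof (rule integral_dominated_convergence)
      show "integrable lborel (\<lambda>t. M * (indicator {..x + 1 - b} t *\<^sub>R norm (rl_kernel s t)))"
        using norm_rl_kernel_integral(1)[OF assms(2)] by (rule integrable_mult_right)
      show "AE t in lborel. norm (rl_kernel s t * (indicator {b<..} (u n - t) *\<^sub>R V (u n - t)))
          \<le> M * (indicator {..x + 1 - b} t *\<^sub>R norm (rl_kernel s t))" for n
        using M[of "u n"] u(2) by (auto simp: less_imp_le simp del: real_scaleR_def)
      show "AE t in lborel. (\<lambda>n. rl_kernel s t * (indicator {b<..} (u n - t) *\<^sub>R V (u n - t)))
          \<longlonglongrightarrow> rl_kernel s t * (indicator {b<..} (x - t) *\<^sub>R V (x - t))"
      \<comment> \<open>The indicator jumps where x - t = b, a single value of t, which is a null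
        set.\<close>
      proof (rule eventually_mono[OF AE_lborel_singleton[of "x - b"]])
        fix t assume t: "t \<noteq> x - b"
        have lim: "(\<lambda>n. u n - t) \<longlonglongrightarrow> x - t" by (intro tendsto_intros u)
        have "(\<lambda>n. indicator {b<..} (u n - t) *\<^sub>R V (u n - t)) \<longlonglongrightarrow> indicator {b<..} (x - t) *\<^sub>R V (x - t)"
        proof (cases "b < x - t")
          case True
          have "(\<lambda>n. V (u n - t)) \<longlonglongrightarrow> V (x - t)"
            using True b by (intro isCont_tendsto_compose[OF cont_causal_isCont[OF V]] lim) auto
          moreover have "\<forall>\<^sub>F n in sequentially. V (u n - t) = indicator {b<..} (u n - t) *\<^sub>R V (u n - t)"
            using order_tendstoD(1)[OF lim True] by eventually_elim simp
          ultimately show ?thesis using True by (simp add: Lim_transform_eventually)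
        next
          case False
          with t have "x - t < b" by simp
          then have "\<forall>\<^sub>F n in sequentially. 0 = indicator {b<..} (u n - t) *\<^sub>R V (u n - t)"
            using order_tendstoD(2)[OF lim, of b] by (auto elim!: eventually_mono)
          then show ?thesis using False by (simp add: Lim_transform_eventually[OF tendsto_const])
        qed
        then show "(\<lambda>n. rl_kernel s t * (indicator {b<..} (u n - t) *\<^sub>R V (u n - t)))
          \<longlonglongrightarrow> rl_kernel s t * (indicator {b<..} (x - t) *\<^sub>R V (x - t))"
          by (rule tendsto_mult_left)
      qed
    qed measurable
    moreover have "rl_conv s V z = (\<integral>y. rl_kernel s (z - y) * (indicator {..b} y *\<^sub>R V y) \<partial>lborel) +
      (\<integral>t. rl_kernel s t * (indicator {b<..} (z - t) *\<^sub>R V (z - t)) \<partial>lborel)" if "b < z" for z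
      by (rule rl_conv_split[OF V b(1) that assms(2)])
    moreover have "b < u n" for n using u(2) b by (meson greaterThanLessThan_iff less_trans)
    ultimately show "(\<lambda>n. rl_conv s V (u n)) \<longlonglongrightarrow> rl_conv s V x"
      using b by (simp add: tendsto_add)
  qed
  then show "isCont (rl_conv s V) x"
    using b by (subst (asm) at_within_open) auto
qed

text \<open>Fubini over z \<le> X: for fixed y the kernel integrates in z to the kernel of order s +
  1 at X - y, divided by s.\<close>

lemma
  assumes V: "V \<in> cont_causal a" and s: "Re s > 0"
  shows rl_conv_integrable: "set_integrable lborel {..X} (rl_conv s V)"
    and rl_conv_integral: "(LINT x:{..X}|lborel. rl_conv s V x) = rl_conv (s + 1) V X / s"
proof -
  note [measurable] = cont_causal_measurable[OF V]
  let ?F = "\<lambda>(y, z). indicator {..X} z *\<^sub>R (rl_kernel s (z - y) * V y)"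
  \<comment> \<open>Translation by y, shaped as the affine map expected by the substitution rules.
    It is polymorphic because it serves both the kernel and its norm.\<close>
  have shift: "(\<lambda>z. indicator {..X} z *\<^sub>R f (z - y)) = (\<lambda>z. indicator {..X - y} (- y + 1 * z) *\<^sub>R f (- y + 1 * z))"
    for y and f :: "real \<Rightarrow> 'b::real_vector"
    by (auto simp: fun_eq_iff indicator_def)
  have I: "integrable lborel (\<lambda>z. indicator {..X} z *\<^sub>R rl_kernel s (z - y))" for y
    unfolding shift
    by (rule lborel_integrable_real_affine[OF rl_kernel_integral(1)[OF s]]) simp
  have E: "(\<integral>z. indicator {..X} z *\<^sub>R rl_kernel s (z - y) \<partial>lborel) = rl_kernel (s + 1) (X - y) / s" for y
    unfolding shift rl_kernel_integral(2)[OF s, symmetric]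
    by (subst lborel_integral_real_affine[where c=1 and t="-y"]) auto
  have N: "(\<integral>z. indicator {..X} z *\<^sub>R norm (rl_kernel s (z - y)) \<partial>lborel) = norm (rl_kernel (s + 1) (X - y)) / Re s" for y
    unfolding shift[of "\<lambda>t. norm (rl_kernel s t)"] norm_rl_kernel_integral(2)[OF s, symmetric]
    by (subst lborel_integral_real_affine[where c=1 and t="-y"]) auto
  have int: "integrable (lborel \<Otimes>\<^sub>M lborel) ?F"
  proof (rule lborel_pair.Fubini_integrable)
    \<comment> \<open>Absolute integrability reduces to order s + 1: integrating the norms in z
      leaves the norm of the integrand of \<open>rl_conv (s + 1) V X\<close>, divided by Re
      s.\<close>
    have "(\<lambda>y. \<integral>z. norm (?F (y, z)) \<partial>lborel) = (\<lambda>y. norm (rl_kernel (s + 1) (X - y) * V y) / Re s)"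
    proof
      fix y
      have "(\<integral>z. norm (?F (y, z)) \<partial>lborel) = (\<integral>z. (indicator {..X} z *\<^sub>R norm (rl_kernel s (z - y))) * norm (V y) \<partial>lborel)"
        by (simp add: norm_mult mult.assoc)
      then show "(\<integral>z. norm (?F (y, z)) \<partial>lborel) = norm (rl_kernel (s + 1) (X - y) * V y) / Re s"
        unfolding integral_mult_left_zero N by (simp add: norm_mult)
    qed
    then show "integrable lborel (\<lambda>y. \<integral>z. norm (?F (y, z)) \<partial>lborel)"
      using rl_integrable[OF V, of "s + 1" X] s by simp
    show "AE y in lborel. integrable lborel (\<lambda>z. ?F (y, z))"
    proof (rule AE_I2)
      fix y show "integrable lborel (\<lambda>z. ?F (y, z))"
        using integrable_mult_left[OF I[of y], of "V y"] by simp
    qed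
  qed measurable
  have zint: "(\<integral>y. indicator {..X} z *\<^sub>R (rl_kernel s (z - y) * V y) \<partial>lborel) = indicator {..X} z *\<^sub>R rl_conv s V z" for z
    by (simp add: rl_conv_def)
  show "set_integrable lborel {..X} (rl_conv s V)"
    using lborel_pair.integrable_snd[OF int] unfolding zint set_integrable_def .
  have "(LINT x:{..X}|lborel. rl_conv s V x) = (\<integral>y. (\<integral>z. indicator {..X} z *\<^sub>R (rl_kernel s (z - y) * V y) \<partial>lborel) \<partial>lborel)"
    using lborel_pair.Fubini_integral[OF int] unfolding zint set_lebesgue_integral_def .
  also have "\<dots> = (\<integral>y. rl_kernel (s + 1) (X - y) * V y / s \<partial>lborel)"
  proof (rule Bochner_Integration.integral_cong)
    fix y
    have "(\<integral>z. indicator {..X} z *\<^sub>R (rl_kernel s (z - y) * V y) \<partial>lborel) =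
       (\<integral>z. (indicator {..X} z *\<^sub>R rl_kernel s (z - y)) * V y \<partial>lborel)" by simp
    then show "(\<integral>z. indicator {..X} z *\<^sub>R (rl_kernel s (z - y) * V y) \<partial>lborel) = rl_kernel (s + 1) (X - y) * V y / s"
      unfolding integral_mult_left_zero E by simp
  qed simp
  also have "\<dots> = rl_conv (s + 1) V X / s"
    by (simp add: rl_conv_def)
  finally show "(LINT x:{..X}|lborel. rl_conv s V x) = rl_conv (s + 1) V X / s" .
qed

section \<open>Derivatives of primitives and limits of difference quotients\<close>

text \<open>h may be singular at a, so the primitive is split at some b between a and x: the part up
  to b is constant in u, and the rest is the fundamental theorem for a continuous function.\<close>

lemma set_integral_has_vector_derivative:
  fixes h :: "real \<Rightarrow> complex"
  assumes "continuous_on {a<..} h" "\<And>u. set_integrable lborel {..u} h" "a < x"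
  shows "((\<lambda>u. LINT z:{..u}|lborel. h z) has_vector_derivative h x) (at x)"
proof -
  define b where "b = (a + x) / 2"
  have b: "a < b" "b < x" using assms(3) by (auto simp: b_def)
  have cont: "continuous_on {b..x + 1} h"
    using assms(1) b by (auto intro: continuous_on_subset)
  have "((\<lambda>u. integral {b..u} h) has_vector_derivative h x) (at x within {b..x + 1})"
    using b by (intro integral_has_vector_derivative[OF cont]) auto
  then have "((\<lambda>u. integral {b..u} h) has_vector_derivative h x) (at x)"
    using b by (simp add: at_within_Icc_at)
  then have "((\<lambda>u. integral {..b} h + integral {b..u} h) has_vector_derivative 0 + h x) (at x)"
    by (intro has_vector_derivative_add has_vector_derivative_const)
  moreover have "integral {..b} h + integral {b..u} h = (LINT z:{..u}|lborel. h z)" if "b < u" for u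
  proof -
    have "h integrable_on {b..u}"
      using assms(1) b by (intro integrable_continuous_interval) (auto intro: continuous_on_subset)
    moreover have "{..b} \<inter> {b..u} = {b}" using that by auto
    ultimately have "(h has_integral integral {..b} h + integral {b..u} h) ({..b} \<union> {b..u})"
      using set_borel_integral_eq_integral(1)[OF assms(2)]
      by (intro has_integral_Un integrable_integral) auto
    also have "{..b} \<union> {b..u} = {..u}" using that by auto
    finally show ?thesis
      using set_borel_integral_eq_integral(2)[OF assms(2)] by (simp add: integral_unique)
  qed
  ultimately show ?thesis
    using b by (auto intro: has_vector_derivative_transform_within_open[where S="{b<..}"])
qed

lemma has_vector_derivative_iff_quotient:
  fixes f :: "real \<Rightarrow> complex"
  shows "(f has_vector_derivative D) (at x) \<longleftrightarrow> ((\<lambda>y. (f y - f x) / of_real (y - x)) \<longlongrightarrow> D) (at x)"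
proof -
  have "norm (f y - f x - (y - x) *\<^sub>R D) / norm (y - x) = norm ((f y - f x) / of_real (y - x) - D)"
    if "y \<noteq> x" for y
  proof -
    have "(f y - f x) / of_real (y - x) - D = (f y - f x - (y - x) *\<^sub>R D) / of_real (y - x)"
      using that by (simp add: scaleR_conv_of_real divide_simps del: of_real_diff)
    then show ?thesis by (simp only: norm_divide norm_of_real real_norm_def)
  qed
  then have "((\<lambda>y. norm (f y - f x - (y - x) *\<^sub>R D) / norm (y - x)) \<longlongrightarrow> 0) (at x) \<longleftrightarrow>
      ((\<lambda>y. norm ((f y - f x) / of_real (y - x) - D)) \<longlongrightarrow> 0) (at x)"
    by (intro filterlim_cong) (auto simp: eventually_at_filter)
  then show ?thesis
    unfolding has_vector_derivative_def has_derivative_iff_norm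
    by (simp only: bounded_linear_scaleR_left simp_thms tendsto_norm_zero_iff Lim_null[where l=D])
qed

section \<open>The space and the operator in terms of the convolution\<close>

lemma causal_space_subset_cont_causal: "causal_space a \<subseteq> cont_causal a"
  by (auto simp: causal_space_def cont_causal_def
      intro!: continuous_at_imp_continuous_on differentiable_imp_continuous_within)

text \<open>Outside ]a, x[ the right side vanishes by itself: f does for y \<le> a, the kernel for y
  \<ge> x.\<close>

lemma J_integrand_eq:
  assumes "f \<in> cont_causal a"
  shows "indicator {a<..<x} y *\<^sub>R J_integrand s f x y = rl_kernel s (x - y) * f y"
  using assms by (auto simp: indicator_def J_integrand_def rl_kernel_def cont_causal_def not_less)

lemma J_op_eq:
  assumes "f \<in> cont_causal a"
  shows "J_op a s f x = 1 / Gamma s * rl_conv s f x"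
  unfolding J_op_def set_lebesgue_integral_def J_integrand_eq[OF assms] rl_conv_def ..

lemma rl_conv_linear:
  assumes "f \<in> cont_causal a" "g \<in> cont_causal a" "Re s > 0"
  shows "rl_conv s (\<lambda>x. l * f x + m * g x) x = l * rl_conv s f x + m * rl_conv s g x"
proof -
  have "rl_conv s (\<lambda>x. l * f x + m * g x) x =
      (\<integral>y. l * (rl_kernel s (x - y) * f y) + m * (rl_kernel s (x - y) * g y) \<partial>lborel)"
    by (simp add: rl_conv_def algebra_simps)
  also have "\<dots> = l * rl_conv s f x + m * rl_conv s g x"
    using rl_integrable[OF assms(1,3)] rl_integrable[OF assms(2,3)]
    by (simp add: rl_conv_def)
  finally show ?thesis .
qed

lemma causal_space_linear:
  assumes "f \<in> causal_space a" "g \<in> causal_space a"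
  shows "(\<lambda>x. l * f x + m * g x) \<in> causal_space a"
  using assms unfolding causal_space_def
  by (auto intro!: differentiable_add differentiable_mult set_integral_add set_integrable_mult_right)

section \<open>Difference quotients as continuous causal functions\<close>

text \<open>\<open>D\<close> is meant to be the derivative of \<open>f\<close> at \<open>x\<close>.\<close>

definition diff_quot :: "real \<Rightarrow> (real \<Rightarrow> complex) \<Rightarrow> real \<Rightarrow> complex \<Rightarrow> real \<Rightarrow> complex" where
  "diff_quot a f x D y =
     (if y \<le> a then 0 else if y = x then D else (f y - f x) / of_real (y - x))"

text \<open>Continuity at x is exactly differentiability of f there. Near a, on y < b < x, the
  denominator is at least x - b in absolute value, so the quotient is dominated by a multiple of the
  integrable f - f(x).\<close>

lemma diff_quot_cont_causal:
  assumes f: "f \<in> cont_causal a" and x: "a < x" and D: "(f has_vector_derivative D) (at x)"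
  shows "diff_quot a f x D \<in> cont_causal a"
proof (rule cont_causalI)
  note [measurable] = cont_causal_measurable[OF f]
  define b where "b = (a + x) / 2"
  have b: "a < b" "b < x" using x by (auto simp: b_def)
  show "a < b" by (rule b)
  have *: "(\<lambda>y. indicator {a<..<b} y *\<^sub>R diff_quot a f x D y) =
     (\<lambda>y. indicator {a<..<b} y *\<^sub>R ((f y - f x) / of_real (y - x)))"
    using b by (auto simp: fun_eq_iff indicator_def diff_quot_def)
  have "set_integrable lborel {a<..<b} (\<lambda>_. f x)"
    unfolding set_integrable_def by (intro integrable_scaleR_left) (auto simp: less_imp_le[OF b(1)])
  moreover have "set_integrable lborel {a<..<b} f" using f b by (simp add: cont_causal_def)
  ultimately have "integrable lborel (\<lambda>y. indicator {a<..<b} y *\<^sub>R (f y - f x))"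
    using set_integral_diff(1)[of lborel "{a<..<b}" f "\<lambda>_. f x"] unfolding set_integrable_def by blast
  then have "integrable lborel (\<lambda>y. (1 / (x - b)) * norm (indicator {a<..<b} y *\<^sub>R (f y - f x)))"
    by (intro integrable_mult_right integrable_norm)
  then show "set_integrable lborel {a<..<b} (diff_quot a f x D)"
    unfolding set_integrable_def *
  proof (rule Bochner_Integration.integrable_bound)
    show "AE y in lborel. norm (indicator {a<..<b} y *\<^sub>R ((f y - f x) / complex_of_real (y - x)))
       \<le> norm (1 / (x - b) * norm (indicator {a<..<b} y *\<^sub>R (f y - f x)))"
    proof (rule AE_I2)
      fix y
      have "norm (f y - f x) / \<bar>y - x\<bar> \<le> norm (f y - f x) / (x - b)" if "y < b"
        using that b by (intro divide_left_mono mult_pos_pos) auto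
      then show "norm (indicator {a<..<b} y *\<^sub>R ((f y - f x) / complex_of_real (y - x)))
       \<le> norm (1 / (x - b) * norm (indicator {a<..<b} y *\<^sub>R (f y - f x)))"
        using b by (auto simp: indicator_def norm_divide simp flip: of_real_diff)
    qed
  qed measurable
  show "continuous_on {a<..} (diff_quot a f x D)"
  proof (rule continuous_at_imp_continuous_on, safe)
    fix z assume z: "a < z"
    show "isCont (diff_quot a f x D) z"
    proof (cases "z = x")
      case True
      have "((\<lambda>y. (f y - f x) / of_real (y - x)) \<longlongrightarrow> D) (at x)"
        using D by (simp only: has_vector_derivative_iff_quotient)
      moreover have "\<forall>\<^sub>F y in at x. (f y - f x) / of_real (y - x) = diff_quot a f x D y"
        using eventually_at_in_open[of "{a<..}" x] x
        by (auto simp: diff_quot_def elim!: eventually_mono)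
      ultimately have "(diff_quot a f x D \<longlongrightarrow> D) (at x)"
        by (rule Lim_transform_eventually)
      then show ?thesis using x True by (simp add: isCont_def diff_quot_def)
    next
      case False
      have "isCont (\<lambda>y. (f y - f x) / of_real (y - x)) z"
        using cont_causal_isCont[OF f z] False by (intro continuous_intros) auto
      moreover have "\<forall>\<^sub>F y in nhds z. diff_quot a f x D y = (f y - f x) / of_real (y - x)"
        using eventually_nhds_in_open[OF open_delete[OF open_greaterThan], of z a x] z False
        by (auto simp: diff_quot_def elim!: eventually_mono)
      ultimately show ?thesis by (simp add: isCont_cong)
    qed
  qed
qed (simp add: diff_quot_def)

section \<open>Differentiability of the convolution and conclusion for \<open>J_op\<close>\<close>

lemma rl_conv_differentiable:
  assumes f: "f \<in> causal_space a" and s: "Re s > 0" and x: "a < x"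
  shows "rl_conv s f differentiable (at x)"
proof -
  have fc: "f \<in> cont_causal a" using f causal_space_subset_cont_causal by auto
  have s0: "s \<noteq> 0" using s by auto
  obtain D where D: "(f has_vector_derivative D) (at x)"
    using f x by (auto simp: causal_space_def vector_derivative_works)
  define v where "v = diff_quot a f x D"
  have v: "v \<in> cont_causal a"
    unfolding v_def by (rule diff_quot_cont_causal[OF fc x D])
  \<comment> \<open>The decomposition at x: \<open>rl_kernel (s + 1) (z - a)\<close> is (z - a)_+^s,
    and \<open>rl_conv s v\<close> is the continuous H.\<close>
  define P where "P z = f x * rl_kernel (s + 1) (z - a) / s + of_real (z - x) * rl_conv s v z
      - s * (LINT w:{..z}|lborel. rl_conv s v w)" for z
  have eq: "rl_conv s f z = P z" for z
  proof -
    have "AE y in lborel. rl_kernel s (z - y) * f y = f x * (indicator {a..} y *\<^sub>R rl_kernel s (z - y)) +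
        of_real (z - x) * (rl_kernel s (z - y) * v y) - rl_kernel (s + 1) (z - y) * v y"
    \<comment> \<open>At y = a the indicator \<open>{a..}\<close> is 1 while f vanishes, so the
      identity can fail there; the point is null.\<close>
    proof (rule eventually_mono[OF AE_lborel_singleton[of a]])
      fix y assume y: "y \<noteq> a"
      show "rl_kernel s (z - y) * f y = f x * (indicator {a..} y *\<^sub>R rl_kernel s (z - y)) +
        of_real (z - x) * (rl_kernel s (z - y) * v y) - rl_kernel (s + 1) (z - y) * v y"
      proof (cases "a < y")
        case False
        then show ?thesis using y fc by (simp add: cont_causal_def v_def diff_quot_def)
      next
        case True
        \<comment> \<open>This includes y = x, where the value D is multiplied by 0.\<close>
        then have "f y = f x + of_real (y - x) * v y"
          by (simp add: v_def diff_quot_def)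
        then show ?thesis
          using True unfolding mult_rl_kernel[symmetric]
          by (simp only: atLeast_iff less_imp_le indicator_simps scaleR_one of_real_diff)
            (simp add: ring_distribs mult_ac)
      qed
    qed
    then have "rl_conv s f z = (\<integral>y. f x * (indicator {a..} y *\<^sub>R rl_kernel s (z - y)) +
        of_real (z - x) * (rl_kernel s (z - y) * v y) - rl_kernel (s + 1) (z - y) * v y \<partial>lborel)"
      unfolding rl_conv_def
      using cont_causal_measurable[OF fc] cont_causal_measurable[OF v]
      by (intro integral_cong_AE) auto
    also have "\<dots> = f x * (rl_kernel (s + 1) (z - a) / s) + of_real (z - x) * rl_conv s v z - rl_conv (s + 1) v z"
      unfolding rl_conv_def rl_kernel_reflect_integral(2)[OF s, symmetric]
      using rl_kernel_reflect_integral(1)[OF s, of a z] rl_integrable[OF v s, of z]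
        rl_integrable[OF v, of "s + 1" z] s
      by (subst Bochner_Integration.integral_diff Bochner_Integration.integral_add;
          (intro Bochner_Integration.integrable_add integrable_mult_right)?; simp del: mult_scaleR_right)+
    \<comment> \<open>The term of order s + 1 becomes s times a primitive of H, so its derivative
      needs only continuity of H.\<close>
    also have "rl_conv (s + 1) v z = s * (LINT w:{..z}|lborel. rl_conv s v w)"
      using rl_conv_integral[OF v s] s0 by simp
    finally show ?thesis by (simp add: P_def)
  qed
  have "((\<lambda>z. z - a) has_vector_derivative 1) (at x)"
    by (auto intro!: derivative_eq_intros)
  from vector_diff_chain_at[OF this rl_kernel_has_vector_derivative[of "x - a" s]] x
  have d1: "(\<lambda>z. rl_kernel (s + 1) (z - a)) differentiable (at x)"
    by (simp add: o_def differentiableI_vector)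
  have "(rl_conv s v \<longlongrightarrow> rl_conv s v x) (at x)"
    using rl_conv_continuous[OF v s] x by (simp add: continuous_on_eq_continuous_at isCont_def)
  \<comment> \<open>The product (z - x) H(z) vanishes at x, so its difference quotient there is H(z)
    itself: continuity of H alone gives the derivative H(x).\<close>
  moreover have "\<forall>\<^sub>F z in at x. rl_conv s v z =
      (of_real (z - x) * rl_conv s v z - of_real (x - x) * rl_conv s v x) / of_real (z - x)"
    by (simp add: eventually_at_filter del: of_real_diff)
  ultimately have d2: "((\<lambda>z. of_real (z - x) * rl_conv s v z) has_vector_derivative rl_conv s v x) (at x)"
    unfolding has_vector_derivative_iff_quotient by (rule Lim_transform_eventually)
  have d3: "((\<lambda>z. LINT w:{..z}|lborel. rl_conv s v w) has_vector_derivative rl_conv s v x) (at x)"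
    by (rule set_integral_has_vector_derivative[OF rl_conv_continuous[OF v s] rl_conv_integrable[OF v s] x])
  have "P differentiable (at x)"
    unfolding P_def[abs_def] divide_inverse
    by (intro differentiable_add differentiable_diff differentiable_mult d1 differentiable_const
      differentiableI_vector[OF d2] differentiableI_vector[OF d3])
  moreover have "rl_conv s f = P" using eq by (rule ext)
  ultimately show ?thesis by simp
qed

text \<open>The first conjunct guarantees that the integrals in \<open>J_op\<close> are genuine and
  not the default value 0 of a nonintegrable function; the second says that the operator maps the
  space into itself.\<close>

theorem theorem1:
  fixes a :: real and s :: complex
  assumes "Re s > 0"
  shows "(\<forall>f\<in>causal_space a. \<forall>x>a. set_integrable lborel {a<..<x} (J_integrand s f x)) \<and>
         (\<forall>f\<in>causal_space a. J_op a s f \<in> causal_space a) \<and>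
         (\<forall>f\<in>causal_space a. \<forall>g\<in>causal_space a. \<forall>l m :: complex.
            (\<lambda>x. l * f x + m * g x) \<in> causal_space a \<and>
            (\<forall>x>a. J_op a s (\<lambda>x. l * f x + m * g x) x = l * J_op a s f x + m * J_op a s g x))"
proof (intro conjI ballI allI impI)
  fix f assume f: "f \<in> causal_space a"
  then have fc: "f \<in> cont_causal a" using causal_space_subset_cont_causal by auto
  show "set_integrable lborel {a<..<x} (J_integrand s f x)" for x
    unfolding set_integrable_def J_integrand_eq[OF fc] by (rule rl_integrable[OF fc assms])
  have "J_op a s f x = 0" if "x \<le> a" for x
    using rl_conv_eq_0(2)[OF fc that] by (simp add: J_op_eq[OF fc])
  moreover have "J_op a s f differentiable (at x)" if "a < x" for x
    unfolding J_op_eq[OF fc, abs_def]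
    by (intro differentiable_mult differentiable_const rl_conv_differentiable[OF f assms that])
  moreover have "set_integrable lborel {a<..<x} (J_op a s f)" for x
  proof -
    \<comment> \<open>Local integrability of the image, up to the endpoint a, comes from the Fubini
      argument on a half-line.\<close>
    have "set_integrable lborel {a<..<x} (rl_conv s f)"
      by (rule set_integrable_subset[OF rl_conv_integrable[OF fc assms, of x]]) auto
    then show ?thesis
      unfolding J_op_eq[OF fc, abs_def] by (intro set_integrable_mult_right) auto
  qed
  ultimately show "J_op a s f \<in> causal_space a"
    by (simp add: causal_space_def)
next
  fix f g l m assume fg: "f \<in> causal_space a" "g \<in> causal_space a"
  show lin: "(\<lambda>x. l * f x + m * g x) \<in> causal_space a"
    by (rule causal_space_linear[OF fg])
  have c: "f \<in> cont_causal a" "g \<in> cont_causal a" "(\<lambda>x. l * f x + m * g x) \<in> cont_causal a"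
    using fg lin causal_space_subset_cont_causal by blast+
  show "J_op a s (\<lambda>x. l * f x + m * g x) x = l * J_op a s f x + m * J_op a s g x" for x
    by (simp add: J_op_eq[OF c(1)] J_op_eq[OF c(2)] J_op_eq[OF c(3)] rl_conv_linear[OF c(1,2) assms]
      add_divide_distrib)
qed

end
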